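(* If $\Gamma\vdash M:\theta\blacktriangleright\chi$ is derivable in the constraint-generating inference system and $\mathcal M$ is a model of the system of constraints $\chi$ in the semiring $\mathcal J$, then the judgment $(\Gamma\vdash M:\theta)[\mathcal M]$ is derivable in the bounded affine type system.
   Context: **Type system.** Let $(\mathcal J,+,\times,\mathbf 0,\mathbf 1)$ be a semiring. Types are $\theta::=\sigma\mid (J\cdot\theta)\multimap\theta$, with $\sigma$ ranging over a fixed collection of base types and $J\in\mathcal J$. Terms are $\lambda$-terms with constants; $fv(M)$ is the set of free variables, and $M[x/y]$ is $M$ with $x$ substituted for $y$. An environment is a list $x_1:J_1\cdot\theta_1,\ldots,x_n:J_n\cdot\theta_n$, and $J\cdot(x_1:K_1\cdot\theta_1,\ldots,x_n:K_n\cdot\theta_n)=x_1:(J\times K_1)\cdot\theta_1,\ldots,x_n:(J\times K_n)\cdot\theta_n$. Rules: - Identity: $x:\mathbf 1\cdot\theta\vdash x:\theta$. - Weakening: from $\Gamma\vdash M:\theta$ infer $\Gamma,x:J\cdot\theta'\vdash M:\theta$, if $x\notin fv(M)$. - Abstraction: from $\Gamma,x:J\cdot\theta\vdash M:\theta'$ infer $\Gamma\vdash\lambda x.M:J\cdot\theta\multimap\theta'$. - Application: from $\Gamma\vdash M:J\cdot\theta\multimap\theta'$ and $\Gamma'\vdash N:\theta$ infer $\Gamma,J\cdot\Gamma'\vdash MN:\theta'$, if $\mathrm{dom}(\Gamma)\cap\mathrm{dom}(\Gamma')=\emptyset$. - Contraction: from $\Gamma,x:J\cdot\theta,y:K\cdot\theta\vdash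 M:\theta'$ infer $\Gamma,x:(J+K)\cdot\theta\vdash M[x/y]:\theta'$. - Constants: there is a set of constants $\mathsf k:\theta$, each with a set of resource constraints $\chi_{\mathsf k}$; the axiom $\emptyset\vdash\mathsf k:\theta[\mathcal M]$ holds for every assignment $\mathcal M$ satisfying $\chi_{\mathsf k}$. Annotations denoting equal elements of $\mathcal J$ are identified. **Constraint-generating system.** Here the annotations $J$ in types and environments may be either elements of $\mathcal J$ or resource variables. Judgments have the form $\Gamma\vdash M:\theta\blacktriangleright\chi$ with $\chi$ a set of equational constraints over $\mathcal J$ (constants may add arbitrary constraints $\chi_{\mathsf k}$). For types of the same underlying shape define $\overline{\sigma=\sigma}=\emptyset$ and $\overline{J_1\cdot\theta_1\multimap\theta_1'=J_2\cdot\theta_2\multimap\theta_2'}=\{J_1=J_2\}\cup\overline{\theta_1=\theta_2}\cup\overline{\theta_1'=\theta_2'}$. Rules (with the same side conditions on variables as in the type system): - $x:\mathbf 1\cdot\theta\vdash x:\theta\blacktriangleright\mathit{true}$ (no constraints). - $\emptyset\vdash\mathsf k:\theta\blacktriangleright\chi_{\mathsf k}$. - From $\Gamma\vdash M:\theta\blacktriangleright\chi$ infer $\Gamma,x:J\cdot\theta'\vdash M:\theta\blacktriangleright\chi$. - From $\Gamma,x:J\cdot\theta\vdash M:\theta'\blacktriangleright\chi$ infer $\Gamma\vdash\lambda x:\theta.M:J\cdot\theta\multimap\theta'\blacktriangleright\chi$ (the annotation on the bound variable is dropped in the type system). - From $\Gamma,x:J_1\cdot\theta',y:J_2\cdot\theta''\vdash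 M:\theta\blacktriangleright\chi$ infer $\Gamma,x:J\cdot\theta'\vdash M[x/y]:\theta\blacktriangleright\chi\cup\{J=J_1+J_2\}\cup\overline{\theta'=\theta''}$. - From $\Gamma\vdash M:J\cdot\theta\multimap\theta'\blacktriangleright\chi$ and $x_1:J_1\cdot\theta_1,\ldots,x_n:J_n\cdot\theta_n\vdash N:\theta''\blacktriangleright\chi'$ infer $\Gamma,x_1:J_1'\cdot\theta_1,\ldots,x_n:J_n'\cdot\theta_n\vdash MN:\theta'\blacktriangleright\chi\cup\chi'\cup\{J_k'=J\times J_k\mid 1\le k\le n\}\cup\overline{\theta=\theta''}$. A model $\mathcal M$ of $\chi$ is a function from resource variables to elements of $\mathcal J$ under which all constraints of $\chi$ hold; $(\Gamma\vdash M:\theta)[\mathcal M]$ is the textual substitution of each resource variable by its value. *)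

theory Defs
  imports Main
begin

section \<open>Types, environments and resource constraints\<close>

text \<open>\<open>Arr J \<theta> \<theta>'\<close> is the type \<open>J\<cdot>\<theta> \<multimap> \<theta>'\<close>.\<close>

datatype ('b, 'a) ty = Base 'b | Arr 'a "('b, 'a) ty" "('b, 'a) ty"

text \<open>The most recently added variable is the last element of the list.\<close>

type_synonym ('x, 'b, 'a) env = "('x \<times> 'a \<times> ('b, 'a) ty) list"

definition env_dom :: "('x, 'b, 'a) env \<Rightarrow> 'x set" where
  "env_dom \<Gamma> = fst ` set \<Gamma>"

definition scale_env :: "'j::times \<Rightarrow> ('x, 'b, 'j) env \<Rightarrow> ('x, 'b, 'j) env" where
  "scale_env J \<Gamma> = map (\<lambda>(x, K, \<theta>). (x, J * K, \<theta>)) \<Gamma>"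

text \<open>Annotations of the constraint-generating system.\<close>

datatype ('j, 'v) ann = Elem 'j | RVar 'v

datatype ('j, 'v) rexp =
    Ann "('j, 'v) ann"
  | Plus "('j, 'v) rexp" "('j, 'v) rexp"
  | Times "('j, 'v) rexp" "('j, 'v) rexp"

text \<open>The inference rules only generate equations. \<open>Cond\<close> is there because the constraints
  attached to constants are arbitrary.\<close>

datatype ('j, 'v) constr =
    Eq "('j, 'v) rexp" "('j, 'v) rexp"
  | Cond "('v \<Rightarrow> 'j) \<Rightarrow> bool"

primrec ann_val :: "('v \<Rightarrow> 'j) \<Rightarrow> ('j, 'v) ann \<Rightarrow> 'j" where
  "ann_val \<M> (Elem J) = J"
| "ann_val \<M> (RVar v) = \<M> v"

primrec rexp_val :: "('v \<Rightarrow> 'j::{semiring_0,monoid_mult}) \<Rightarrow> ('j, 'v) rexp \<Rightarrow> 'j" where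
  "rexp_val \<M> (Ann a) = ann_val \<M> a"
| "rexp_val \<M> (Plus e f) = rexp_val \<M> e + rexp_val \<M> f"
| "rexp_val \<M> (Times e f) = rexp_val \<M> e * rexp_val \<M> f"

primrec satisfies :: "('v \<Rightarrow> 'j::{semiring_0,monoid_mult}) \<Rightarrow> ('j, 'v) constr \<Rightarrow> bool" where
  "satisfies \<M> (Eq e f) \<longleftrightarrow> rexp_val \<M> e = rexp_val \<M> f"
| "satisfies \<M> (Cond P) \<longleftrightarrow> P \<M>"

definition model :: "('v \<Rightarrow> 'j::{semiring_0,monoid_mult}) \<Rightarrow> ('j, 'v) constr set \<Rightarrow> bool" where
  "model \<M> \<chi> \<longleftrightarrow> (\<forall>c\<in>\<chi>. satisfies \<M> c)"

definition same_shape :: "('b, 'a) ty \<Rightarrow> ('b, 'a) ty \<Rightarrow> bool" where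
  "same_shape \<theta> \<theta>' \<longleftrightarrow> map_ty id (\<lambda>_. ()) \<theta> = map_ty id (\<lambda>_. ()) \<theta>'"

text \<open>Only meaningful for types of the same shape; the rules below require this wherever
  \<open>ty_eqs\<close> is used.\<close>

fun ty_eqs :: "('b, ('j, 'v) ann) ty \<Rightarrow> ('b, ('j, 'v) ann) ty \<Rightarrow> ('j, 'v) constr set" where
  "ty_eqs (Base _) (Base _) = {}"
| "ty_eqs (Arr J\<^sub>1 \<theta>\<^sub>1 \<theta>\<^sub>1') (Arr J\<^sub>2 \<theta>\<^sub>2 \<theta>\<^sub>2') =
     {Eq (Ann J\<^sub>1) (Ann J\<^sub>2)} \<union> ty_eqs \<theta>\<^sub>1 \<theta>\<^sub>2 \<union> ty_eqs \<theta>\<^sub>1' \<theta>\<^sub>2'"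
| "ty_eqs _ _ = undefined"


section \<open>Terms\<close>

text \<open>Terms up to alpha-equivalence, in locally nameless form: bound occurrences are de Bruijn
  indices, free variables are names. Hence \<open>fv\<close>, the set of names in a term, is its set of free
  variables, and replacing a name by another cannot cause capture. \<open>'a\<close> is the type of annotations
  on bound variables, with \<open>'a = unit\<close> for terms without annotations.\<close>

datatype (fv: 'x, 'k, 'a) trm =
    Free 'x
  | Bound nat
  | Const 'k
  | App "('x, 'k, 'a) trm" "('x, 'k, 'a) trm"
  | Lam 'a "('x, 'k, 'a) trm"

primrec bind_var :: "nat \<Rightarrow> 'x \<Rightarrow> ('x, 'k, 'a) trm \<Rightarrow> ('x, 'k, 'a) trm" where
  "bind_var n x (Free y) = (if y = x then Bound n else Free y)"
| "bind_var n x (Bound i) = Bound i"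
| "bind_var n x (Const k) = Const k"
| "bind_var n x (App M N) = App (bind_var n x M) (bind_var n x N)"
| "bind_var n x (Lam a M) = Lam a (bind_var (Suc n) x M)"

text \<open>\<open>lam x a M\<close> is the term \<open>\<lambda>x:a. M\<close> with a named bound variable.\<close>

definition lam :: "'x \<Rightarrow> 'a \<Rightarrow> ('x, 'k, 'a) trm \<Rightarrow> ('x, 'k, 'a) trm" where
  "lam x a M = Lam a (bind_var 0 x M)"

text \<open>\<open>subst_var M x y\<close> is \<open>M[x/y]\<close>: \<open>x\<close> replaces \<open>y\<close>.\<close>

definition subst_var :: "('x, 'k, 'a) trm \<Rightarrow> 'x \<Rightarrow> 'x \<Rightarrow> ('x, 'k, 'a) trm" where
  "subst_var M x y = map_trm (\<lambda>z. if z = y then x else z) id id M"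

definition erase :: "('x, 'k, 'a) trm \<Rightarrow> ('x, 'k, unit) trm" where
  "erase = map_trm id id (\<lambda>_. ())"


section \<open>Substitution of resource variables by their values\<close>

definition inst_ty :: "('v \<Rightarrow> 'j) \<Rightarrow> ('b, ('j, 'v) ann) ty \<Rightarrow> ('b, 'j) ty" where
  "inst_ty \<M> = map_ty id (ann_val \<M>)"

definition inst_env :: "('v \<Rightarrow> 'j) \<Rightarrow> ('x, 'b, ('j, 'v) ann) env \<Rightarrow> ('x, 'b, 'j) env" where
  "inst_env \<M> = map (\<lambda>(x, J, \<theta>). (x, ann_val \<M> J, inst_ty \<M> \<theta>))"

definition inst_trm ::
  "('v \<Rightarrow> 'j) \<Rightarrow> ('x, 'k, ('b, ('j, 'v) ann) ty) trm \<Rightarrow> ('x, 'k, ('b, 'j) ty) trm" where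
  "inst_trm \<M> = map_trm id id (inst_ty \<M>)"


section \<open>The two inference systems\<close>

text \<open>The constant \<open>k\<close> has type \<open>\<tau> k\<close> and resource constraints \<open>X k\<close>. Annotations in the type system
  are elements of the semiring itself, so that annotations denoting equal elements are identified.
  The sort \<open>{semiring_0,monoid_mult}\<close> is that of semirings with one; unlike \<open>semiring_1\<close> it does not
  demand \<open>0 \<noteq> 1\<close>.\<close>

inductive typing ::
  "('k \<Rightarrow> ('b, ('j::{semiring_0,monoid_mult}, 'v) ann) ty) \<Rightarrow> ('k \<Rightarrow> ('j, 'v) constr set) \<Rightarrow>
   ('x, 'b, 'j) env \<Rightarrow> ('x, 'k, unit) trm \<Rightarrow> ('b, 'j) ty \<Rightarrow> bool"
  for \<tau> X where
  Identity: "typing \<tau> X [(x, 1, \<theta>)] (Free x) \<theta>"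
| Weakening: "typing \<tau> X (\<Gamma> @ [(x, J, \<theta>')]) M \<theta>"
    if "typing \<tau> X \<Gamma> M \<theta>" "x \<notin> fv M"
| Abstraction: "typing \<tau> X \<Gamma> (lam x () M) (Arr J \<theta> \<theta>')"
    if "typing \<tau> X (\<Gamma> @ [(x, J, \<theta>)]) M \<theta>'"
| Application: "typing \<tau> X (\<Gamma> @ scale_env J \<Gamma>') (App M N) \<theta>'"
    if "typing \<tau> X \<Gamma> M (Arr J \<theta> \<theta>')" "typing \<tau> X \<Gamma>' N \<theta>" "env_dom \<Gamma> \<inter> env_dom \<Gamma>' = {}"
| Contraction: "typing \<tau> X (\<Gamma> @ [(x, J + K, \<theta>)]) (subst_var M x y) \<theta>'"
    if "typing \<tau> X (\<Gamma> @ [(x, J, \<theta>), (y, K, \<theta>)]) M \<theta>'"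
| Constant: "typing \<tau> X [] (Const k) (inst_ty \<M> (\<tau> k))"
    if "model \<M> (X k)"

text \<open>In \<open>CApplication\<close> the list \<open>\<Delta>\<close> holds the tuples \<open>(x\<^sub>k, J\<^sub>k, J\<^sub>k', \<theta>\<^sub>k)\<close>, where \<open>J\<^sub>k\<close> annotates
  \<open>x\<^sub>k\<close> in the premise and \<open>J\<^sub>k'\<close> annotates it in the conclusion.\<close>

inductive cgen ::
  "('k \<Rightarrow> ('b, ('j::{semiring_0,monoid_mult}, 'v) ann) ty) \<Rightarrow> ('k \<Rightarrow> ('j, 'v) constr set) \<Rightarrow>
   ('x, 'b, ('j, 'v) ann) env \<Rightarrow> ('x, 'k, ('b, ('j, 'v) ann) ty) trm \<Rightarrow> ('b, ('j, 'v) ann) ty \<Rightarrow>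
   ('j, 'v) constr set \<Rightarrow> bool"
  for \<tau> X where
  CIdentity: "cgen \<tau> X [(x, Elem 1, \<theta>)] (Free x) \<theta> {}"
| CConstant: "cgen \<tau> X [] (Const k) (\<tau> k) (X k)"
| CWeakening: "cgen \<tau> X (\<Gamma> @ [(x, J, \<theta>')]) M \<theta> \<chi>"
    if "cgen \<tau> X \<Gamma> M \<theta> \<chi>" "x \<notin> fv M"
| CAbstraction: "cgen \<tau> X \<Gamma> (lam x \<theta> M) (Arr J \<theta> \<theta>') \<chi>"
    if "cgen \<tau> X (\<Gamma> @ [(x, J, \<theta>)]) M \<theta>' \<chi>"
| CContraction:
    "cgen \<tau> X (\<Gamma> @ [(x, J, \<theta>')]) (subst_var M x y) \<theta>
       (\<chi> \<union> {Eq (Ann J) (Plus (Ann J\<^sub>1) (Ann J\<^sub>2))} \<union> ty_eqs \<theta>' \<theta>'')"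
    if "cgen \<tau> X (\<Gamma> @ [(x, J\<^sub>1, \<theta>'), (y, J\<^sub>2, \<theta>'')]) M \<theta> \<chi>" "same_shape \<theta>' \<theta>''"
| CApplication:
    "cgen \<tau> X (\<Gamma> @ map (\<lambda>(x, K, K', \<phi>). (x, K', \<phi>)) \<Delta>) (App M N) \<theta>'
       (\<chi> \<union> \<chi>' \<union> {Eq (Ann K') (Times (Ann J) (Ann K)) |x K K' \<phi>. (x, K, K', \<phi>) \<in> set \<Delta>}
          \<union> ty_eqs \<theta> \<theta>'')"
    if "cgen \<tau> X \<Gamma> M (Arr J \<theta> \<theta>') \<chi>"
      "cgen \<tau> X (map (\<lambda>(x, K, K', \<phi>). (x, K, \<phi>)) \<Delta>) N \<theta>'' \<chi>'"
      "env_dom \<Gamma> \<inter> fst ` set \<Delta> = {}" "same_shape \<theta> \<theta>''"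

end

theory Submission imports Defs begin

text \<open>By induction on the constraint-generating derivation, each rule becomes its typing
  counterpart once \<M> is substituted. The generated equations are what the typing rules enforce by
  using one type or one semiring expression in two places. Constraint sets only grow from premises
  to conclusion, so a single \<M> serves the whole derivation.
  \<open>inst_ty_eq_if_model_ty_eqs\<close> turns solved type equations into equal types, and
  \<open>inst_env_eq_scale_env\<close> turns solved product equations into a scaled environment. On
  terms, \<M> touches only binder annotations, which \<open>erase\<close> deletes; erasure keeps
  free variables and commutes with \<open>lam\<close> and \<open>subst_var\<close>.\<close>

lemma erase_inst_trm [simp]: "erase (inst_trm \<M> M) = erase M"
  by (simp add: erase_def inst_trm_def trm.map_comp comp_def id_def)

lemma erase_simps [simp]:
  "erase (Free x) = Free x"
  "erase (Const k) = Const k"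
  "erase (App M N) = App (erase M) (erase N)"
  by (simp_all add: erase_def)

lemma fv_erase [simp]: "fv (erase M) = fv M"
  by (simp add: erase_def trm.set_map)

lemma erase_bind_var: "erase (bind_var n x M) = bind_var n x (erase M)"
  by (induction M arbitrary: n) (simp_all add: erase_def)

lemma erase_lam: "erase (lam x a M) = lam x () (erase M)"
  by (simp add: lam_def erase_bind_var[symmetric]) (simp add: erase_def)

lemma erase_subst_var: "erase (subst_var M x y) = subst_var (erase M) x y"
  by (simp add: erase_def subst_var_def trm.map_comp comp_def id_def)

lemma inst_ty_Arr [simp]:
  "inst_ty \<M> (Arr J \<theta> \<theta>') = Arr (ann_val \<M> J) (inst_ty \<M> \<theta>) (inst_ty \<M> \<theta>')"
  by (simp add: inst_ty_def)

lemma inst_env_append [simp]: "inst_env \<M> (\<Gamma> @ \<Delta>) = inst_env \<M> \<Gamma> @ inst_env \<M> \<Delta>"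
  by (simp add: inst_env_def)

lemma inst_env_Nil [simp]: "inst_env \<M> [] = []"
  by (simp add: inst_env_def)

lemma inst_env_Cons [simp]:
  "inst_env \<M> ((x, J, \<theta>) # \<Gamma>) = (x, ann_val \<M> J, inst_ty \<M> \<theta>) # inst_env \<M> \<Gamma>"
  by (simp add: inst_env_def)

lemma env_dom_inst_env [simp]: "env_dom (inst_env \<M> \<Gamma>) = env_dom \<Gamma>"
  by (force simp: env_dom_def inst_env_def)

lemma model_Un [simp]: "model \<M> (\<chi> \<union> \<chi>') \<longleftrightarrow> model \<M> \<chi> \<and> model \<M> \<chi>'"
  by (auto simp: model_def)

lemma model_insert [simp]: "model \<M> (insert c \<chi>) \<longleftrightarrow> satisfies \<M> c \<and> model \<M> \<chi>"
  by (simp add: model_def)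

text \<open>The equations compare annotations at corresponding positions. \<open>same_shape\<close>
  makes the base types agree and rules out the mismatched clauses, where \<open>ty_eqs\<close> is
  \<open>undefined\<close>.\<close>

lemma inst_ty_eq_if_model_ty_eqs:
  assumes "same_shape \<theta> \<theta>'" "model \<M> (ty_eqs \<theta> \<theta>')"
  shows "inst_ty \<M> \<theta> = inst_ty \<M> \<theta>'"
  using assms by (induction \<theta> \<theta>' rule: ty_eqs.induct) (simp_all add: same_shape_def inst_ty_def)

text \<open>Names and types are shared by both readings of \<Delta>, so only the annotations need
  comparing. Here \<open>J\<close> is already a semiring element.\<close>

lemma inst_env_eq_scale_env:
  assumes "\<And>x K K' \<phi>. (x, K, K', \<phi>) \<in> set \<Delta> \<Longrightarrow> ann_val \<M> K' = J * ann_val \<M> K"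
  shows "inst_env \<M> (map (\<lambda>(x, K, K', \<phi>). (x, K', \<phi>)) \<Delta>) =
    scale_env J (inst_env \<M> (map (\<lambda>(x, K, K', \<phi>). (x, K, \<phi>)) \<Delta>))"
  using assms by (fastforce simp: inst_env_def scale_env_def)

theorem theorem1:
  fixes \<tau> :: "'k \<Rightarrow> ('b, ('j::{semiring_0,monoid_mult}, 'v) ann) ty"
    and X :: "'k \<Rightarrow> ('j, 'v) constr set"
    and \<Gamma> :: "('x, 'b, ('j, 'v) ann) env"
    and M :: "('x, 'k, ('b, ('j, 'v) ann) ty) trm"
    and \<theta> :: "('b, ('j, 'v) ann) ty"
    and \<chi> :: "('j, 'v) constr set"
    and \<M> :: "'v \<Rightarrow> 'j"
  assumes "cgen \<tau> X \<Gamma> M \<theta> \<chi>"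
    and "model \<M> \<chi>"
  shows "typing \<tau> X (inst_env \<M> \<Gamma>) (erase (inst_trm \<M> M)) (inst_ty \<M> \<theta>)"
  using assms
proof (induction rule: cgen.induct)
  case (CIdentity x \<theta>)
  show ?case by (simp add: Identity)
next
  case (CConstant k)
  then show ?case by (simp add: Constant)
next
  case (CWeakening \<Gamma> M \<theta> \<chi> x J \<theta>')
  then show ?case by (simp add: Weakening)
next
  case (CAbstraction \<Gamma> x J \<theta> M \<theta>' \<chi>)
  then show ?case by (simp add: erase_lam Abstraction)
next
  case (CContraction \<Gamma> x J\<^sub>1 \<theta>' y J\<^sub>2 \<theta>'' M \<theta> \<chi> J)
  \<comment> \<open>\<open>Contraction\<close> merges only variables of one type; this identifies
    the two.\<close>
  then have "inst_ty \<M> \<theta>'' = inst_ty \<M> \<theta>'"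
    using inst_ty_eq_if_model_ty_eqs[of \<theta>' \<theta>'' \<M>] by simp
  with CContraction show ?case by (simp add: erase_subst_var Contraction)
next
  case (CApplication \<Gamma> M J \<theta> \<theta>' \<chi> \<Delta> N \<theta>'' \<chi>')
  let ?\<Gamma>' = "map (\<lambda>(x, K, K', \<phi>). (x, K, \<phi>)) \<Delta>"
  \<comment> \<open>The argument now has exactly the type that the function expects.\<close>
  have "inst_ty \<M> \<theta>'' = inst_ty \<M> \<theta>"
    using CApplication inst_ty_eq_if_model_ty_eqs[of \<theta> \<theta>'' \<M>] by simp
  moreover have "env_dom ?\<Gamma>' = fst ` set \<Delta>"
    by (force simp: env_dom_def)
  moreover have "ann_val \<M> K' = ann_val \<M> J * ann_val \<M> K" if "(x, K, K', \<phi>) \<in> set \<Delta>" for x K K' \<phi>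
  proof -
    \<comment> \<open>This equation was generated for the chosen entry of \<Delta>.\<close>
    have "satisfies \<M> (Eq (Ann K') (Times (Ann J) (Ann K)))"
      using CApplication.prems that unfolding model_def by blast
    then show ?thesis by simp
  qed
  then have "inst_env \<M> (map (\<lambda>(x, K, K', \<phi>). (x, K', \<phi>)) \<Delta>) =
      scale_env (ann_val \<M> J) (inst_env \<M> ?\<Gamma>')"
    by (rule inst_env_eq_scale_env)
  ultimately show ?case
    using CApplication by (auto intro!: Application)
qed

end
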